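(* Let $n\in\mathbb{N}=\{0,1,2,\ldots\}$. (i) For every positive integer $m$, the following polynomial identity holds: $$S_n^{(m)}(x)=\sum_{k=0}^n\binom nk^2x^{2k}\left(\sum_{j=0}^{n-k}\binom n{j+k}^{m-1}\binom{n-k}jx^j\right)^2.$$ Also, $$S_n^{(0)}(x)=\sum_{k=0}^{n}x^{2k}\left(\sum_{j=0}^{n-k}\binom{j+k}kx^j\right)^2.$$ (ii) We have the identities $$S_n^{(1)}(x)=\sum_{k=0}^n\binom nk^2x^{2k}(1+x)^{2(n-k)}=\sum_{k=0}^n\binom nk\binom{n+k}kx^{2k}(2x+1)^{n-k}$$ and the recurrence $$(n+2)S_{n+2}^{(1)}(x)=(2n+3)(2x^2+2x+1)S_{n+1}^{(1)}(x)-(n+1)(2x+1)^2S_n^{(1)}(x).$$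
   Context: For $m,n\in\mathbb{N}=\{0,1,2,\ldots\}$, the polynomial $S_n^{(m)}(x)\in\mathbb{Z}[x]$ is defined by $$S_n^{(m)}(x)=\sum_{i=0}^n\sum_{j=0}^n\binom ni^m\binom nj^m\binom{i+j}ix^{i+j}.$$ *)

theory Defs
  imports "HOL-Computational_Algebra.Polynomial"
begin

abbreviation X :: "int poly" where
  "X \<equiv> monom 1 1"

definition S :: "nat \<Rightarrow> nat \<Rightarrow> int poly" where
  "S m n = (\<Sum>i=0..n. \<Sum>j=0..n.
     of_nat (n choose i) ^ m * of_nat (n choose j) ^ m * of_nat ((i + j) choose i) * X ^ (i + j))"

end

(*
  Vandermonde's identity (i+j choose i) = sum_k (i choose k) (j choose k) diagonalises the double
  sum, turning S_n^(m)(x) into a sum of squares; trinomial revision gives the stated shape.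
  For m = 1 put a = x^2 and b = (1+x)^2, so b - a = 2x + 1. Expanding b^(n-k) in powers of a and
  b - a, again with Vandermonde, gives the second formula of (ii). Its coefficients
  (n choose k)(n+k choose k) satisfy a Zeilberger-type recurrence which implies the recurrence
  for S_n^(1).
*)
theory Submission
  imports Defs
begin

section \<open>Vandermonde sums and the sum-of-squares form\<close>

lemma vandermonde_diagonal:
  assumes "i \<le> N"
  shows "(\<Sum>k\<le>N. (i choose k) * (j choose k)) = (i + j) choose i"
proof -
  have "(i + j) choose i = (\<Sum>k\<le>i. (j choose k) * (i choose (i - k)))"
    using vandermonde[of j i i] by (simp add: add.commute)
  also have "\<dots> = (\<Sum>k\<le>i. (i choose k) * (j choose k))"
    by (intro sum.cong refl) (simp add: binomial_symmetric[symmetric] mult.commute)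
  \<comment> \<open>Terms with k > i vanish. A bound \<open>N\<close> independent of i is what later
    allows the sum over k to be moved outside the sums over i and j.\<close>
  also have "\<dots> = (\<Sum>k\<le>N. (i choose k) * (j choose k))"
    using assms by (intro sum.mono_neutral_left) auto
  finally show ?thesis by simp
qed

text \<open>The symmetric Pascal matrix with entries (i + j choose i) factors as L times its
  transpose, where L is the lower triangular matrix of (i choose k). A quadratic form with this
  matrix is therefore a sum of squares, one for each column k of L.\<close>

lemma binomial_double_sum_eq_sum_squares:
  fixes f :: "nat \<Rightarrow> 'a::comm_ring_1"
  shows "(\<Sum>i=0..n. \<Sum>j=0..n. f i * f j * of_nat ((i + j) choose i)) =
    (\<Sum>k=0..n. (\<Sum>j=0..n - k. f (j + k) * of_nat ((j + k) choose k)) ^ 2)"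
proof -
  have "(\<Sum>i=0..n. \<Sum>j=0..n. f i * f j * of_nat ((i + j) choose i)) =
    (\<Sum>i=0..n. \<Sum>j=0..n. \<Sum>k=0..n.
      (f i * of_nat (i choose k)) * (f j * of_nat (j choose k)))"
    by (intro sum.cong refl)
      (simp flip: vandermonde_diagonal[of _ n] atLeast0AtMost
        add: sum_distrib_left algebra_simps)
  also have "\<dots> = (\<Sum>k=0..n. \<Sum>i=0..n. \<Sum>j=0..n.
      (f i * of_nat (i choose k)) * (f j * of_nat (j choose k)))"
    by (rule trans[OF sum.cong[OF refl sum.swap] sum.swap])
  also have "\<dots> = (\<Sum>k=0..n. (\<Sum>i=0..n. f i * of_nat (i choose k)) ^ 2)"
    by (simp add: power2_eq_square sum_product)
  also have "\<dots> = (\<Sum>k=0..n. (\<Sum>j=0..n - k. f (j + k) * of_nat ((j + k) choose k)) ^ 2)"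
  proof (rule sum.cong[OF refl], rule arg_cong[where f = "\<lambda>y. y ^ 2"])
    fix k assume "k \<in> {0..n}"
    \<comment> \<open>Column k of L starts at row k, so the substitution i = j + k loses only zero
      terms.\<close>
    then have "(\<Sum>j=0..n - k. f (j + k) * of_nat ((j + k) choose k)) =
        (\<Sum>i=k..n. f i * of_nat (i choose k))"
      using sum.shift_bounds_cl_nat_ivl[of "\<lambda>i. f i * of_nat (i choose k)" 0 k "n - k"] by simp
    also have "\<dots> = (\<Sum>i=0..n. f i * of_nat (i choose k))"
      by (intro sum.mono_neutral_left) (auto simp: not_le binomial_eq_0)
    finally show "(\<Sum>i=0..n. f i * of_nat (i choose k)) =
        (\<Sum>j=0..n - k. f (j + k) * of_nat ((j + k) choose k))" by simp
  qed
  finally show ?thesis .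
qed

text \<open>The weights are f i = (n choose i)^m X^i, and X^k is pulled out of the k-th square. This
  form is uniform in m, so m = 0 can be read off directly.\<close>

lemma S_eq_sum_squares:
  "S m n = (\<Sum>k=0..n. X ^ (2 * k) *
    (\<Sum>j=0..n - k. of_nat (n choose (j + k)) ^ m * of_nat ((j + k) choose k) * X ^ j) ^ 2)"
proof -
  have "S m n = (\<Sum>i=0..n. \<Sum>j=0..n.
      (of_nat (n choose i) ^ m * X ^ i) * (of_nat (n choose j) ^ m * X ^ j) *
        of_nat ((i + j) choose i))"
    unfolding S_def by (intro sum.cong refl) (simp only: power_add ac_simps)
  also have "\<dots> = (\<Sum>k=0..n. (\<Sum>j=0..n - k.
      of_nat (n choose (j + k)) ^ m * X ^ (j + k) * of_nat ((j + k) choose k)) ^ 2)"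
    by (rule binomial_double_sum_eq_sum_squares)
  also have "\<dots> = (\<Sum>k=0..n. (X ^ k * (\<Sum>j=0..n - k.
      of_nat (n choose (j + k)) ^ m * of_nat ((j + k) choose k) * X ^ j)) ^ 2)"
    by (simp only: sum_distrib_left power_add ac_simps)
  finally show ?thesis
    by (simp only: power_mult_distrib power_even_eq)
qed

text \<open>Since m > 0, one factor (n choose (j + k)) can be split off and merged with ((j + k)
  choose k) by trinomial revision. The resulting factor (n choose k) does not depend on j, so it
  leaves the inner sum and is squared.\<close>

lemma S_pos:
  assumes "m > 0"
  shows "S m n = (\<Sum>k=0..n. of_nat (n choose k) ^ 2 * X ^ (2 * k) *
    (\<Sum>j=0..n - k. of_nat (n choose (j + k)) ^ (m - 1) * of_nat ((n - k) choose j) * X ^ j) ^ 2)"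
proof -
  have rev: "of_nat (n choose (j + k)) ^ m * of_nat ((j + k) choose k) =
      of_nat (n choose k) * (of_nat (n choose (j + k)) ^ (m - 1) * of_nat ((n - k) choose j) :: int poly)"
    if "k \<le> n" "j \<le> n - k" for j k
  proof -
    have "(n choose (j + k)) * ((j + k) choose k) = (n choose k) * ((n - k) choose j)"
      using that choose_mult[of k "j + k" n] by simp
    then have "of_nat (n choose (j + k)) * of_nat ((j + k) choose k) =
        (of_nat (n choose k) * of_nat ((n - k) choose j) :: int poly)"
      by (metis of_nat_mult)
    moreover obtain l where "m = Suc l" using assms gr0_implies_Suc by blast
    ultimately show ?thesis by (simp add: ac_simps)
  qed
  have "S m n = (\<Sum>k=0..n. X ^ (2 * k) * (of_nat (n choose k) *
    (\<Sum>j=0..n - k. of_nat (n choose (j + k)) ^ (m - 1) * of_nat ((n - k) choose j) * X ^ j)) ^ 2)"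
    unfolding S_eq_sum_squares
    by (intro sum.cong refl arg_cong2[where f = "(*)"] arg_cong[where f = "\<lambda>y. y ^ 2"])
      (auto simp: sum_distrib_left rev mult.assoc intro!: sum.cong)
  then show ?thesis by (simp only: power_mult_distrib ac_simps)
qed

section \<open>Passing from powers of a and a + c to powers of a and c\<close>

lemma sum_binomial_square_eq:
  fixes a c :: "'a::comm_ring_1"
  shows "(\<Sum>k\<le>n. of_nat (n choose k) ^ 2 * a ^ k * (a + c) ^ (n - k)) =
    (\<Sum>k\<le>n. of_nat (n choose k) * of_nat ((n + k) choose k) * a ^ k * c ^ (n - k))"
proof -
  \<comment> \<open>Expand (a + c)^(n - k) and collect by l = j + k. Trinomial revision takes (n
    choose l) out of the coefficient of a^l c^(n - l), leaving the sum over k of (n choose k) (l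
    choose k), which Vandermonde evaluates.\<close>
  have "(\<Sum>k\<le>n. of_nat (n choose k) ^ 2 * a ^ k * (a + c) ^ (n - k)) =
    (\<Sum>k\<le>n. \<Sum>l=k..n. of_nat (n choose l) * a ^ l * c ^ (n - l) *
      of_nat ((n choose k) * (l choose k)))"
  proof (intro sum.cong refl)
    fix k assume "k \<in> {..n}"
    then have k: "k \<le> n" by simp
    have "of_nat (n choose k) ^ 2 * a ^ k * (a + c) ^ (n - k) =
      (\<Sum>j=0..n - k. of_nat (n choose k) ^ 2 * a ^ k *
        (of_nat ((n - k) choose j) * a ^ j * c ^ (n - k - j)))"
      by (simp add: binomial_ring sum_distrib_left atLeast0AtMost)
    also have "\<dots> = (\<Sum>j=0..n - k. of_nat (n choose (j + k)) * a ^ (j + k) * c ^ (n - (j + k)) *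
        of_nat ((n choose k) * ((j + k) choose k)))"
    proof (intro sum.cong refl)
      fix j assume "j \<in> {0..n - k}"
      then have "(n choose (j + k)) * ((j + k) choose k) = (n choose k) * ((n - k) choose j)"
        using k choose_mult[of k "j + k" n] by simp
      then have "of_nat (n choose (j + k)) * of_nat ((j + k) choose k) =
          (of_nat (n choose k) * of_nat ((n - k) choose j) :: 'a)"
        by (metis of_nat_mult)
      then have "of_nat (n choose (j + k)) * of_nat ((j + k) choose k) *
          (of_nat (n choose k) * a ^ (j + k) * c ^ (n - (j + k))) =
          of_nat (n choose k) * of_nat ((n - k) choose j) *
          (of_nat (n choose k) * a ^ (j + k) * c ^ (n - (j + k)))"
        by simp
      then show "of_nat (n choose k) ^ 2 * a ^ k *
          (of_nat ((n - k) choose j) * a ^ j * c ^ (n - k - j)) =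
        of_nat (n choose (j + k)) * a ^ (j + k) * c ^ (n - (j + k)) *
          of_nat ((n choose k) * ((j + k) choose k))"
        by (simp add: power2_eq_square power_add ac_simps)
    qed
    also have "\<dots> = (\<Sum>l=k..n. of_nat (n choose l) * a ^ l * c ^ (n - l) *
        of_nat ((n choose k) * (l choose k)))"
      using k sum.shift_bounds_cl_nat_ivl[of "\<lambda>l. of_nat (n choose l) * a ^ l * c ^ (n - l) *
        of_nat ((n choose k) * (l choose k))" 0 k "n - k"] by simp
    finally show "of_nat (n choose k) ^ 2 * a ^ k * (a + c) ^ (n - k) =
      (\<Sum>l=k..n. of_nat (n choose l) * a ^ l * c ^ (n - l) *
        of_nat ((n choose k) * (l choose k)))" .
  qed
  also have "\<dots> = (\<Sum>k\<le>n. \<Sum>l\<le>n. of_nat (n choose l) * a ^ l * c ^ (n - l) *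
      of_nat ((n choose k) * (l choose k)))"
    by (rule sum.cong[OF refl], rule sum.mono_neutral_left)
      (auto simp: not_le binomial_eq_0)
  also have "\<dots> = (\<Sum>l\<le>n. of_nat (n choose l) * a ^ l * c ^ (n - l) *
      of_nat (\<Sum>k\<le>n. (n choose k) * (l choose k)))"
    by (subst sum.swap) (simp add: sum_distrib_left)
  also have "\<dots> = (\<Sum>l\<le>n. of_nat (n choose l) * of_nat ((n + l) choose l) * a ^ l * c ^ (n - l))"
    using vandermonde_diagonal[where j = n and N = n]
    by (intro sum.cong refl) (simp add: ac_simps)
  finally show ?thesis .
qed

section \<open>Delannoy coefficients and their recurrence\<close>

definition delannoy_coeff :: "nat \<Rightarrow> nat \<Rightarrow> nat" where
  "delannoy_coeff n k = (n choose k) * ((n + k) choose k)"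

lemma delannoy_coeff_eq_0: "n < k \<Longrightarrow> delannoy_coeff n k = 0"
  by (simp add: delannoy_coeff_def)

text \<open>Working over \<open>int\<close> avoids truncated subtraction, so the relation holds for
  every k: both sides are zero when k > n.\<close>

lemma int_binomial_row:
  "(int n + 1 - int k) * int (Suc n choose k) = (int n + 1) * int (n choose k)"
proof (cases "k \<le> Suc n")
  case True
  then show ?thesis
    using arg_cong[OF binomial_absorb_comp[of "Suc n" k], of int]
    by (simp only: of_nat_mult of_nat_diff of_nat_Suc diff_Suc_1 add.commute)
qed (simp add: binomial_eq_0)

lemma int_binomial_diag:
  "(int k + 1) * int (Suc n choose Suc k) = (int n + 1) * int (n choose k)"
  using arg_cong[OF Suc_times_binomial[of k n], of int]
  by (simp only: of_nat_mult of_nat_Suc add.commute)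

lemma int_binomial_column:
  "(int k + 1) * int (n choose Suc k) = (int n - int k) * int (n choose k)"
  using int_binomial_diag[of k n] int_binomial_row[of n k]
  by (simp add: algebra_simps)

text \<open>Multiplied by (k + 1)^2, each coefficient in column k + 1 becomes a polynomial in n and
  k times \<open>delannoy_coeff (n + 1) k\<close>. The claim reduces to a polynomial identity, after
  which the nonzero factor (k + 1)^2 is cancelled.\<close>

lemma delannoy_coeff_recurrence:
  "int (n + 2) * int (delannoy_coeff (n + 2) (Suc k)) =
    int (2 * n + 3) * (2 * int (delannoy_coeff (n + 1) k) + int (delannoy_coeff (n + 1) (Suc k)))
    - int (n + 1) * int (delannoy_coeff n (Suc k))"
proof -
  let ?k = "int k" and ?m = "int n + 1"
  let ?u = "int (delannoy_coeff (n + 1) k)"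
  let ?c = "\<lambda>n. int (n choose k)" and ?d = "\<lambda>n. int (n choose Suc k)"
  have A: "(?k + 1)^2 * int (delannoy_coeff (n + 2) (Suc k)) = (?m + ?k + 2) * (?m + ?k + 1) * ?u"
  proof -
    \<comment> \<open>The first two relations reach column k; the third lowers the second binomial
      to row n + k + 1 and absorbs the factor \<open>?m + 1\<close> of the first.\<close>
    have "(?k + 1) * ?d (n + 2) = (?m + 1) * ?c (n + 1)"
      "(?k + 1) * ?d (n + k + 3) = (?m + ?k + 2) * ?c (n + k + 2)"
      "(?m + 1) * ?c (n + k + 2) = (?m + ?k + 1) * ?c (n + k + 1)"
      using int_binomial_diag[of k "n + 1"] int_binomial_diag[of k "n + k + 2"]
        int_binomial_row[of "n + k + 1" k]
      by (simp_all add: numeral_eq_Suc algebra_simps)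
    then have "((?k + 1) * ?d (n + 2)) * ((?k + 1) * ?d (n + k + 3)) =
      (?m + ?k + 2) * (?m + ?k + 1) * (?c (n + 1) * ?c (n + k + 1))"
      by algebra
    then show ?thesis
      by (simp add: delannoy_coeff_def power2_eq_square numeral_eq_Suc ac_simps)
  qed
  have B: "(?k + 1)^2 * int (delannoy_coeff (n + 1) (Suc k)) = (?m + ?k + 1) * (?m - ?k) * ?u"
  proof -
    have "(?k + 1) * ?d (n + 1) = (?m - ?k) * ?c (n + 1)"
      "(?k + 1) * ?d (n + k + 2) = (?m + ?k + 1) * ?c (n + k + 1)"
      using int_binomial_column[of k "n + 1"] int_binomial_diag[of k "n + k + 1"]
      by (simp_all add: numeral_eq_Suc algebra_simps)
    then have "((?k + 1) * ?d (n + 1)) * ((?k + 1) * ?d (n + k + 2)) =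
      (?m + ?k + 1) * (?m - ?k) * (?c (n + 1) * ?c (n + k + 1))"
      by algebra
    then show ?thesis
      by (simp add: delannoy_coeff_def power2_eq_square numeral_eq_Suc ac_simps)
  qed
  have C: "(?k + 1)^2 * int (delannoy_coeff n (Suc k)) = (?m - 1 - ?k) * (?m - ?k) * ?u"
  proof -
    have "(?k + 1) * ?d n = (?m - 1 - ?k) * ?c n"
      "(?k + 1) * ?d (n + k + 1) = ?m * ?c (n + k + 1)"
      "?m * ?c n = (?m - ?k) * ?c (n + 1)"
      using int_binomial_column[of k n] int_binomial_column[of k "n + k + 1"]
        int_binomial_row[of n k]
      by (simp_all add: algebra_simps)
    then have "((?k + 1) * ?d n) * ((?k + 1) * ?d (n + k + 1)) =
      (?m - 1 - ?k) * (?m - ?k) * (?c (n + 1) * ?c (n + k + 1))"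
      by algebra
    then show ?thesis
      by (simp add: delannoy_coeff_def power2_eq_square ac_simps)
  qed
  have "(?k + 1)^2 * (int (n + 2) * int (delannoy_coeff (n + 2) (Suc k))) =
    int (n + 2) * ((?k + 1)^2 * int (delannoy_coeff (n + 2) (Suc k)))" by simp
  also have "\<dots> = int (2 * n + 3) * (2 * (?k + 1)^2 * ?u + (?k + 1)^2 * int (delannoy_coeff (n + 1) (Suc k)))
    - int (n + 1) * ((?k + 1)^2 * int (delannoy_coeff n (Suc k)))"
    unfolding A B C by (simp add: power2_eq_square algebra_simps)
  also have "\<dots> = (?k + 1)^2 * (int (2 * n + 3) * (2 * ?u + int (delannoy_coeff (n + 1) (Suc k)))
    - int (n + 1) * int (delannoy_coeff n (Suc k)))"
    by (simp only: algebra_simps)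
  finally show ?thesis by simp
qed

text \<open>This is the Legendre polynomial P_n homogenised, c^n P_n(1 + 2a/c), written without
  division. At a = c = 1 it gives the central Delannoy numbers.\<close>

definition delannoy_form :: "'a \<Rightarrow> 'a \<Rightarrow> nat \<Rightarrow> 'a::comm_ring_1" where
  "delannoy_form a c n = (\<Sum>k\<le>n. of_nat (delannoy_coeff n k) * a ^ k * c ^ (n - k))"

text \<open>This is Bonnet's recursion for Legendre polynomials, homogenised. All terms are expanded
  in c^(n + 2) and the monomials a^(k + 1) c^(n + 1 - k) with k \<le> n + 1, and coefficients are
  compared.\<close>

lemma delannoy_form_recurrence:
  fixes a c :: "'a::comm_ring_1"
  shows "of_nat (n + 2) * delannoy_form a c (n + 2) =
    of_nat (2 * n + 3) * (2 * a + c) * delannoy_form a c (n + 1)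
    - of_nat (n + 1) * c ^ 2 * delannoy_form a c n"
proof -
  let ?t = "\<lambda>n k. of_nat (delannoy_coeff n k) :: 'a"
  have coeff: "of_nat (n + 2) * ?t (n + 2) (Suc k) =
      of_nat (2 * n + 3) * (2 * ?t (n + 1) k + ?t (n + 1) (Suc k)) - of_nat (n + 1) * ?t n (Suc k)"
    for k
    using arg_cong[OF delannoy_coeff_recurrence[of n k], of "of_int :: int \<Rightarrow> 'a"]
    by (simp only: of_int_mult of_int_add of_int_diff of_int_of_nat_eq of_int_numeral)
  have 0: "delannoy_form a c (n + 2) =
      c ^ (n + 2) + (\<Sum>k\<le>n + 1. ?t (n + 2) (Suc k) * (a ^ Suc k * c ^ (n + 1 - k)))"
    by (simp add: delannoy_form_def sum.atMost_Suc_shift delannoy_coeff_def ac_simps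
        del: sum.atMost_Suc)
  have 1: "a * delannoy_form a c (n + 1) =
      (\<Sum>k\<le>n + 1. ?t (n + 1) k * (a ^ Suc k * c ^ (n + 1 - k)))"
    by (simp add: delannoy_form_def sum_distrib_left ac_simps del: sum.atMost_Suc)
  have 2: "c * delannoy_form a c (n + 1) =
      c ^ (n + 2) + (\<Sum>k\<le>n + 1. ?t (n + 1) (Suc k) * (a ^ Suc k * c ^ (n + 1 - k)))"
  proof -
    have "c * delannoy_form a c (n + 1) = (\<Sum>k\<le>n + 1. ?t (n + 1) k * (a ^ k * c ^ (n + 2 - k)))"
      unfolding delannoy_form_def sum_distrib_left
      by (intro sum.cong refl) (simp add: Suc_diff_le ac_simps)
    \<comment> \<open>The added coefficient at k = n + 2 is zero; the longer range gives the common
      shape once k = 0 is split off.\<close>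
    also have "\<dots> = (\<Sum>k\<le>Suc (n + 1). ?t (n + 1) k * (a ^ k * c ^ (n + 2 - k)))"
      by (simp add: delannoy_coeff_eq_0)
    finally show ?thesis
      unfolding sum.atMost_Suc_shift by (simp add: delannoy_coeff_def del: sum.atMost_Suc)
  qed
  have 3: "c ^ 2 * delannoy_form a c n =
      c ^ (n + 2) + (\<Sum>k\<le>n + 1. ?t n (Suc k) * (a ^ Suc k * c ^ (n + 1 - k)))"
  proof -
    have "c ^ 2 * delannoy_form a c n = (\<Sum>k\<le>n. ?t n k * (a ^ k * c ^ (n + 2 - k)))"
      unfolding delannoy_form_def sum_distrib_left
      by (intro sum.cong refl) (simp add: Suc_diff_le power2_eq_square ac_simps)
    \<comment> \<open>Here two zero coefficients are added, at k = n + 1 and k = n + 2.\<close>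
    also have "\<dots> = (\<Sum>k\<le>Suc (n + 1). ?t n k * (a ^ k * c ^ (n + 2 - k)))"
      by (simp add: delannoy_coeff_eq_0)
    finally show ?thesis
      unfolding sum.atMost_Suc_shift by (simp add: delannoy_coeff_def del: sum.atMost_Suc)
  qed
  let ?p = "\<lambda>k. a ^ Suc k * c ^ (n + 1 - k)"
  have "of_nat (n + 2) * delannoy_form a c (n + 2) =
      of_nat (n + 2) * c ^ (n + 2) + (\<Sum>k\<le>n + 1. (of_nat (n + 2) * ?t (n + 2) (Suc k)) * ?p k)"
    unfolding 0 by (simp only: distrib_left sum_distrib_left mult.assoc)
  also have "\<dots> = of_nat (2 * n + 3) * (2 * (\<Sum>k\<le>n + 1. ?t (n + 1) k * ?p k) +
        (c ^ (n + 2) + (\<Sum>k\<le>n + 1. ?t (n + 1) (Suc k) * ?p k))) -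
      of_nat (n + 1) * (c ^ (n + 2) + (\<Sum>k\<le>n + 1. ?t n (Suc k) * ?p k))"
  proof -
    have sums: "(\<Sum>k\<le>n + 1. (of_nat (n + 2) * ?t (n + 2) (Suc k)) * ?p k) =
        of_nat (2 * n + 3) * (2 * (\<Sum>k\<le>n + 1. ?t (n + 1) k * ?p k) +
          (\<Sum>k\<le>n + 1. ?t (n + 1) (Suc k) * ?p k)) -
        of_nat (n + 1) * (\<Sum>k\<le>n + 1. ?t n (Suc k) * ?p k)"
      unfolding coeff
      by (simp only: sum_distrib_left left_diff_distrib distrib_right distrib_left sum.distrib
          sum_subtractf mult.assoc)
    \<comment> \<open>This balances the term c^(n + 2), which \<open>coeff\<close> does not
      cover.\<close>
    have factor: "(of_nat (n + 2) :: 'a) = of_nat (2 * n + 3) - of_nat (n + 1)"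
      by simp
    show ?thesis
      unfolding sums unfolding factor by (simp only: algebra_simps)
  qed
  also have "\<dots> = of_nat (2 * n + 3) * (2 * (a * delannoy_form a c (n + 1)) +
      c * delannoy_form a c (n + 1)) - of_nat (n + 1) * (c ^ 2 * delannoy_form a c n)"
    unfolding 1 2 3 ..
  finally show ?thesis
    by (simp only: distrib_left distrib_right mult.assoc)
qed

section \<open>The case m = 1\<close>

lemma S_1_binomial:
  "S 1 n = (\<Sum>k=0..n. of_nat (n choose k) ^ 2 * X ^ (2 * k) * (1 + X) ^ (2 * (n - k)))"
proof -
  have "(\<Sum>j=0..k. of_nat (k choose j) * X ^ j) = (1 + X) ^ k" for k
    using binomial_ring[of X 1 k] by (simp add: atLeast0AtMost add.commute)
  then show ?thesis
    unfolding S_pos[OF zero_less_one] by (simp add: power_even_eq)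
qed

text \<open>With a = X^2 and c = 2X + 1, the sum a + c is (1 + X)^2, and 2a + c is the factor 2X^2 +
  2X + 1 of the final recurrence.\<close>

lemma S_1_delannoy: "S 1 n = delannoy_form (X ^ 2) (2 * X + 1) n"
proof -
  have sq: "X ^ 2 + (2 * X + 1) = (1 + X) ^ 2"
    by (simp only: power2_sum) simp
  show ?thesis
    unfolding S_1_binomial delannoy_form_def delannoy_coeff_def of_nat_mult
      sum_binomial_square_eq[symmetric] sq
    by (simp only: power_mult atLeast0AtMost)
qed

theorem theorem1p1:
  fixes n :: nat
  shows
    "(\<forall>m::nat. m > 0 \<longrightarrow>
        S m n = (\<Sum>k=0..n. of_nat (n choose k) ^ 2 * X ^ (2 * k) *
          (\<Sum>j=0..n - k. of_nat (n choose (j + k)) ^ (m - 1) * of_nat ((n - k) choose j) * X ^ j) ^ 2))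
     \<and> S 0 n = (\<Sum>k=0..n. X ^ (2 * k) * (\<Sum>j=0..n - k. of_nat ((j + k) choose k) * X ^ j) ^ 2)
     \<and> S 1 n = (\<Sum>k=0..n. of_nat (n choose k) ^ 2 * X ^ (2 * k) * (1 + X) ^ (2 * (n - k)))
     \<and> S 1 n = (\<Sum>k=0..n. of_nat (n choose k) * of_nat ((n + k) choose k) * X ^ (2 * k) * (2 * X + 1) ^ (n - k))
     \<and> of_nat (n + 2) * S 1 (n + 2) =
         of_nat (2 * n + 3) * (2 * X ^ 2 + 2 * X + 1) * S 1 (n + 1)
         - of_nat (n + 1) * (2 * X + 1) ^ 2 * S 1 n"
proof (intro conjI allI impI)
  show "S 0 n = (\<Sum>k=0..n. X ^ (2 * k) * (\<Sum>j=0..n - k. of_nat ((j + k) choose k) * X ^ j) ^ 2)"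
    unfolding S_eq_sum_squares by simp
  show "S 1 n = (\<Sum>k=0..n. of_nat (n choose k) * of_nat ((n + k) choose k) * X ^ (2 * k) * (2 * X + 1) ^ (n - k))"
    unfolding S_1_delannoy delannoy_form_def delannoy_coeff_def of_nat_mult
    by (simp only: power_mult atLeast0AtMost)
  show "of_nat (n + 2) * S 1 (n + 2) =
         of_nat (2 * n + 3) * (2 * X ^ 2 + 2 * X + 1) * S 1 (n + 1)
         - of_nat (n + 1) * (2 * X + 1) ^ 2 * S 1 n"
    unfolding S_1_delannoy delannoy_form_recurrence by (simp only: add.assoc)
qed (fact S_pos S_1_binomial)+

end
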